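(* Fix $1\leq p<\infty$. Let $T$ be a nonzero bounded linear operator on the Hardy space $H^p$. Then $T$ is almost multiplicative if and only if $T$ is a composition operator.
   Context: $\mathbb{D}$ is the open unit disc in $\mathbb{C}$. $H^p$ is the Banach space of analytic functions $f$ on $\mathbb{D}$ with $\|f\|_p=\sup_{0\le r<1}\left(\frac{1}{2\pi}\int_0^{2\pi}|f(re^{i\theta})|^p\,d\theta\right)^{1/p}<\infty$. A bounded linear operator $T$ on a space $\mathcal{A}$ of analytic functions on $\mathbb{D}$ is almost multiplicative if $T(fg)=T(f)T(g)$ whenever $f,g,fg\in\mathcal{A}$ (pointwise product). $T$ is a composition operator on $\mathcal{A}$ if there is an analytic map $\varphi:\mathbb{D}\to\mathbb{D}$ such that $Tf=f\circ\varphi$ for all $f\in\mathcal{A}$. *)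

theory Defs
  imports "HOL-Complex_Analysis.Complex_Analysis"
begin

abbreviation unit_disc :: "complex set" where
  "unit_disc \<equiv> ball 0 1"

text \<open>
  A function on the disc is represented by its extension by zero to the whole complex plane.
  Hence two such functions are equal as HOL functions iff they agree on the disc, and pointwise
  sums, scalar multiples and products on the disc are the pointwise ones of HOL.
\<close>

definition disc_analytic :: "(complex \<Rightarrow> complex) set" where
  "disc_analytic = {f. f holomorphic_on unit_disc \<and> (\<forall>z. z \<notin> unit_disc \<longrightarrow> f z = 0)}"

definition integral_mean :: "real \<Rightarrow> (complex \<Rightarrow> complex) \<Rightarrow> real \<Rightarrow> real" where
  "integral_mean p f r =
     (1 / (2 * pi) * integral {0..2 * pi} (\<lambda>\<theta>. cmod (f (of_real r * cis \<theta>)) powr p)) powr (1 / p)"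

text \<open>
  A supremum of real numbers is meaningful in HOL only for sets that are bounded above, so
  finiteness of the supremum is expressed by \<^const>\<open>bdd_above\<close>.
\<close>

definition hardy_norm :: "real \<Rightarrow> (complex \<Rightarrow> complex) \<Rightarrow> real" where
  "hardy_norm p f = (SUP r\<in>{0..<1}. integral_mean p f r)"

definition hardy_space :: "real \<Rightarrow> (complex \<Rightarrow> complex) set" where
  "hardy_space p = {f \<in> disc_analytic. bdd_above (integral_mean p f ` {0..<1})}"

definition bounded_linear_operator_on ::
  "(complex \<Rightarrow> complex) set \<Rightarrow> ((complex \<Rightarrow> complex) \<Rightarrow> real) \<Rightarrow>
   ((complex \<Rightarrow> complex) \<Rightarrow> (complex \<Rightarrow> complex)) \<Rightarrow> bool" where
  "bounded_linear_operator_on A N T \<longleftrightarrow>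
     (\<forall>f\<in>A. T f \<in> A) \<and>
     (\<forall>f\<in>A. \<forall>g\<in>A. T (\<lambda>z. f z + g z) = (\<lambda>z. T f z + T g z)) \<and>
     (\<forall>c. \<forall>f\<in>A. T (\<lambda>z. c * f z) = (\<lambda>z. c * T f z)) \<and>
     (\<exists>C. \<forall>f\<in>A. N (T f) \<le> C * N f)"

definition almost_multiplicative ::
  "(complex \<Rightarrow> complex) set \<Rightarrow> ((complex \<Rightarrow> complex) \<Rightarrow> (complex \<Rightarrow> complex)) \<Rightarrow> bool" where
  "almost_multiplicative A T \<longleftrightarrow>
     (\<forall>f\<in>A. \<forall>g\<in>A. (\<lambda>z. f z * g z) \<in> A \<longrightarrow> T (\<lambda>z. f z * g z) = (\<lambda>z. T f z * T g z))"

definition composition_operator ::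
  "(complex \<Rightarrow> complex) set \<Rightarrow> ((complex \<Rightarrow> complex) \<Rightarrow> (complex \<Rightarrow> complex)) \<Rightarrow> bool" where
  "composition_operator A T \<longleftrightarrow>
     (\<exists>\<phi>. \<phi> holomorphic_on unit_disc \<and> \<phi> ` unit_disc \<subseteq> unit_disc \<and>
          (\<forall>f\<in>A. \<forall>z\<in>unit_disc. T f z = f (\<phi> z)))"

end

theory Submission
  imports Defs
begin

text \<open>
  The constant \<open>1\<close> is mapped to an idempotent analytic function, hence to \<open>1\<close>; put
  \<open>\<phi> = T z\<close>. For \<open>\<bar>\<lambda>\<bar> > 1\<close> the function \<open>\<lambda> - z\<close> is invertible in \<open>H\<^sup>p\<close>, so \<open>\<bar>\<phi>\<bar> \<le> 1\<close>. If \<open>\<bar>\<phi>\<bar>\<close>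
  attains the value \<open>1\<close>, then \<open>\<phi>\<close> is a unimodular constant \<open>\<lambda>\<close>, and \<open>T\<close> maps
  \<open>((1 + cnj \<lambda> z) / 2)\<^sup>n\<close> to \<open>1\<close> for all \<open>n\<close>, although these functions tend to \<open>0\<close> in \<open>H\<^sup>p\<close>. Finally, with
  \<open>\<lambda> = \<phi> w\<close>, applying \<open>T\<close> to \<open>f - f \<lambda> = (z - \<lambda>) g\<close> and evaluating at \<open>w\<close> gives
  \<open>T f w = f (\<phi> w)\<close>.
\<close>

section \<open>Membership in the Hardy space\<close>

definition on_disc :: "(complex \<Rightarrow> complex) \<Rightarrow> complex \<Rightarrow> complex" where
  "on_disc f z = (if z \<in> unit_disc then f z else 0)"

lemma on_disc_simps [simp]:
  "z \<in> unit_disc \<Longrightarrow> on_disc f z = f z"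
  "z \<notin> unit_disc \<Longrightarrow> on_disc f z = 0"
  by (simp_all add: on_disc_def)

lemma on_disc_analytic: "f holomorphic_on unit_disc \<Longrightarrow> on_disc f \<in> disc_analytic"
  unfolding disc_analytic_def by (auto intro: holomorphic_transform)

lemma circle_in_unit_disc: "r \<in> {0..<1} \<Longrightarrow> of_real r * cis t \<in> unit_disc"
  by (simp add: norm_mult)

lemma disc_analytic_powr_integrable:
  assumes "f \<in> disc_analytic" "r \<in> {0..<1}" "0 < p"
  shows "(\<lambda>\<theta>. cmod (f (of_real r * cis \<theta>)) powr p) integrable_on {a..b}"
proof (rule integrable_continuous_interval)
  have "continuous_on unit_disc f"
    using assms(1) by (simp add: disc_analytic_def holomorphic_on_imp_continuous_on)
  then have "continuous_on {a..b} (\<lambda>\<theta>. f (of_real r * cis \<theta>))"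
    by (rule continuous_on_compose2)
      (use circle_in_unit_disc[OF assms(2)] in \<open>auto intro!: continuous_intros\<close>)
  \<comment> \<open>Positivity of \<open>p\<close> matters at the zeros of \<open>f\<close>, where
    the base of the power vanishes.\<close>
  then show "continuous_on {a..b} (\<lambda>\<theta>. cmod (f (of_real r * cis \<theta>)) powr p)"
    using assms(3) by (intro continuous_on_powr' continuous_intros) auto
qed

text \<open>A sum of two nonnegative terms is at most twice the larger one, whose power is at most
  the sum of both powers. This crude replacement for Minkowski's inequality is enough where only
  finiteness is at stake.\<close>

lemma powr_affine_bound:
  fixes M K x :: real
  assumes "0 \<le> M" "0 \<le> K" "0 \<le> x" "0 < p" "0 \<le> y" "y \<le> M + K * x"
  shows "y powr p \<le> (2 * M) powr p + (2 * K) powr p * x powr p"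
proof -
  have "y powr p \<le> (max (2 * M) (2 * (K * x))) powr p"
    using assms by (intro powr_mono2) auto
  also have "\<dots> \<le> (2 * M) powr p + (2 * (K * x)) powr p"
    by (simp add: max_def)
  also have "(2 * (K * x)) powr p = (2 * K) powr p * x powr p"
    using assms by (simp add: powr_mult)
  finally show ?thesis .
qed

lemma zero_in_hardy_space: "(\<lambda>z. 0) \<in> hardy_space p"
  by (auto simp: hardy_space_def disc_analytic_def integral_mean_def)

text \<open>The common source of the membership claims below: an affine pointwise bound carries over
  to the integrals over each circle, with constants independent of the radius. Bounded functions are
  the case \<open>f = 0\<close>.\<close>

lemma hardy_space_dominated:
  assumes p: "0 < p" and g: "g \<in> disc_analytic" and f: "f \<in> hardy_space p"
    and le: "\<And>z. z \<in> unit_disc \<Longrightarrow> cmod (g z) \<le> M + K * cmod (f z)"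
  shows "g \<in> hardy_space p"
proof -
  let ?J = "\<lambda>h r. integral {0..2 * pi} (\<lambda>\<theta>. cmod (h (of_real r * cis \<theta>)) powr p)"
  \<comment> \<open>Absolute values, because \<open>M\<close> and \<open>K\<close> carry no sign
    assumption while the power estimate asks for nonnegative constants.\<close>
  define c where "c = (2 * \<bar>M\<bar>) powr p"
  define d where "d = (2 * \<bar>K\<bar>) powr p"
  have fa: "f \<in> disc_analytic" and "bdd_above (integral_mean p f ` {0..<1})"
    using f by (auto simp: hardy_space_def)
  then obtain B where B: "\<And>r. r \<in> {0..<1} \<Longrightarrow> integral_mean p f r \<le> B"
    unfolding bdd_above_def by blast
  have "integral_mean p g r \<le> (1 / (2 * pi) * (2 * pi * c + d * (2 * pi * B powr p))) powr (1 / p)"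
    if r: "r \<in> {0..<1}" for r
  proof -
    note int = disc_analytic_powr_integrable[OF _ r p]
    \<comment> \<open>True for every \<open>h\<close>, since the integral of a non-integrable
      function is 0 by default.\<close>
    have Jnn: "0 \<le> ?J h r" for h
      by (cases "(\<lambda>\<theta>. cmod (h (of_real r * cis \<theta>)) powr p) integrable_on {0..2 * pi}")
        (auto intro: integral_nonneg simp: not_integrable_integral)
    have "1 / (2 * pi) * ?J f r = integral_mean p f r powr p"
      using p Jnn[of f] by (simp add: integral_mean_def powr_powr)
    also have "\<dots> \<le> B powr p"
      using B[OF r] p by (intro powr_mono2) (auto simp: integral_mean_def)
    finally have Jf: "?J f r \<le> 2 * pi * B powr p"
      by (simp add: field_simps)
    have "?J g r \<le> integral {0..2 * pi} (\<lambda>\<theta>. c + d * cmod (f (of_real r * cis \<theta>)) powr p)"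
    proof (rule integral_le)
      fix \<theta> :: real
      let ?z = "of_real r * cis \<theta>"
      have "M \<le> \<bar>M\<bar>" "K * cmod (f ?z) \<le> \<bar>K\<bar> * cmod (f ?z)"
        by (auto intro: mult_right_mono)
      then have "cmod (g ?z) \<le> \<bar>M\<bar> + \<bar>K\<bar> * cmod (f ?z)"
        using le[OF circle_in_unit_disc[OF r, of \<theta>]] by linarith
      then show "cmod (g ?z) powr p \<le> c + d * cmod (f ?z) powr p"
        unfolding c_def d_def using p by (intro powr_affine_bound) auto
    qed (use int[OF g] int[OF fa] in \<open>auto intro!: integrable_add integrable_on_mult_right\<close>)
    also have "\<dots> = 2 * pi * c + d * ?J f r"
      by (subst integral_add) (use int[OF fa] in \<open>auto intro!: integrable_on_mult_right\<close>)
    also have "\<dots> \<le> 2 * pi * c + d * (2 * pi * B powr p)"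
      using Jf by (intro add_left_mono mult_left_mono) (auto simp: d_def)
    finally show ?thesis
      unfolding integral_mean_def using p Jnn[of g]
      by (intro powr_mono2 mult_left_mono) auto
  qed
  then have "bdd_above (integral_mean p g ` {0..<1})"
    by (intro bdd_aboveI2)
  then show ?thesis using g by (simp add: hardy_space_def)
qed

lemma hardy_space_bounded:
  assumes "0 < p" "f holomorphic_on unit_disc" "\<And>z. z \<in> unit_disc \<Longrightarrow> cmod (f z) \<le> M"
  shows "on_disc f \<in> hardy_space p"
  by (rule hardy_space_dominated[where M = M and K = 0, OF assms(1) _ zero_in_hardy_space])
    (use assms on_disc_analytic in auto)

lemma hardy_space_diff_const:
  assumes "0 < p" "f \<in> hardy_space p"
  shows "on_disc (\<lambda>z. f z - c) \<in> hardy_space p"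
proof (rule hardy_space_dominated[OF assms(1) _ assms(2)])
  show "on_disc (\<lambda>z. f z - c) \<in> disc_analytic"
    using assms(2)
    by (intro on_disc_analytic holomorphic_intros) (auto simp: hardy_space_def disc_analytic_def)
  show "cmod (on_disc (\<lambda>z. f z - c) z) \<le> cmod c + 1 * cmod (f z)" if "z \<in> unit_disc" for z
    using that norm_triangle_ineq4[of "f z" c] by simp
qed

text \<open>The difference quotient has a removable singularity at \<open>a\<close>. Near
  \<open>a\<close> it is bounded by compactness; near the unit circle, dividing by
  \<open>z - a\<close> costs only a constant factor. Together these give an affine bound in terms of
  \<open>f\<close>.\<close>

lemma hardy_space_divide_root:
  assumes p: "0 < p" and f: "f \<in> hardy_space p" and a: "a \<in> unit_disc"
  obtains g where "g \<in> hardy_space p" "\<And>z. z \<in> unit_disc \<Longrightarrow> f z - f a = (z - a) * g z"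
proof -
  \<comment> \<open>Split into two fractions to match the form of
    \<open>pole_theorem\<close>.\<close>
  define h where "h z = (if z = a then deriv f a else f z / (z - a) - f a / (z - a))" for z
  have fh: "f holomorphic_on unit_disc"
    using f by (simp add: hardy_space_def disc_analytic_def)
  have hh: "h holomorphic_on unit_disc"
    unfolding h_def using fh a by (intro pole_theorem) (auto simp: interior_open)
  have eq: "f z - f a = (z - a) * h z" for z
    by (auto simp: h_def diff_divide_distrib[symmetric])
  \<comment> \<open>A radius strictly between \<open>cmod a\<close> and 1: the closed disc of radius
    \<open>s\<close> is compact inside the unit disc, and outside it \<open>z\<close> stays at
    distance at least \<open>s - cmod a\<close> from \<open>a\<close>.\<close>
  define s where "s = (1 + cmod a) / 2"
  have s: "cmod a < s" "s < 1" using a by (auto simp: s_def)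
  have "compact (h ` cball 0 s)"
    using s by (intro compact_continuous_image holomorphic_on_imp_continuous_on
        holomorphic_on_subset[OF hh]) auto
  then have "bounded (h ` cball 0 s)" by (rule compact_imp_bounded)
  then obtain M where M: "\<And>z. cmod z \<le> s \<Longrightarrow> cmod (h z) \<le> M"
    unfolding bounded_iff by (metis image_eqI mem_cball_0)
  have "0 \<le> M" using M[of a] s norm_ge_zero[of "h a"] by linarith
  have "on_disc h \<in> hardy_space p"
  proof (rule hardy_space_dominated[OF p on_disc_analytic[OF hh] f])
    fix z assume z: "z \<in> unit_disc"
    let ?K = "1 / (s - cmod a)"
    show "cmod (on_disc h z) \<le> (M + ?K * cmod (f a)) + ?K * cmod (f z)"
    proof (cases "cmod z \<le> s")
      case True
      have "cmod (h z) \<le> M" by (rule M[OF True])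
      moreover have "0 \<le> ?K * cmod (f a)" "0 \<le> ?K * cmod (f z)" using s by auto
      ultimately show ?thesis using z by simp
    next
      case False
      have "s - cmod a \<le> cmod (z - a)" using False norm_triangle_ineq2[of z a] by linarith
      then have "(s - cmod a) * cmod (h z) \<le> cmod (z - a) * cmod (h z)"
        by (intro mult_right_mono) auto
      also have "\<dots> = cmod (f z - f a)" by (simp add: eq norm_mult)
      also have "\<dots> \<le> cmod (f z) + cmod (f a)" by (rule norm_triangle_ineq4)
      finally have "cmod (h z) \<le> (cmod (f z) + cmod (f a)) / (s - cmod a)"
        using s by (simp add: pos_le_divide_eq mult.commute)
      then show ?thesis using z \<open>0 \<le> M\<close> by (simp add: add_divide_distrib)
    qed
  qed
  then show ?thesis by (rule that) (simp add: eq)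
qed

section \<open>Norm estimates for the constant 1 and for powers of a peak function\<close>

lemma hardy_norm_one:
  assumes "0 < p"
  shows "1 \<le> hardy_norm p (on_disc (\<lambda>z. 1))"
proof -
  have "on_disc (\<lambda>z. 1) \<in> hardy_space p"
    using assms by (intro hardy_space_bounded[where M = 1]) auto
  \<comment> \<open>A lower bound suffices, so one radius is enough; at radius 0 the mean is that of
    the constant 1. Membership makes the supremum one of a bounded set.\<close>
  then have "integral_mean p (on_disc (\<lambda>z. 1)) 0 \<le> hardy_norm p (on_disc (\<lambda>z. 1))"
    unfolding hardy_norm_def by (intro cSUP_upper) (auto simp: hardy_space_def)
  then show ?thesis by (simp add: integral_mean_def)
qed

text \<open>Dominated convergence with majorant 1: the powers tend pointwise to the indicator of the
  set where \<open>g\<close> equals 1, and a countable set is null.\<close>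

lemma integral_power_tendsto_0:
  fixes g :: "real \<Rightarrow> real"
  assumes "continuous_on {a..b} g" "\<And>x. x \<in> {a..b} \<Longrightarrow> 0 \<le> g x" "\<And>x. x \<in> {a..b} \<Longrightarrow> g x \<le> 1"
    and "countable {x. g x = 1}"
  shows "(\<lambda>n. integral {a..b} (\<lambda>x. g x ^ n)) \<longlonglongrightarrow> 0"
proof -
  let ?l = "\<lambda>x. if g x = 1 then 1 else (0::real)"
  have "(\<lambda>n. integral {a..b} (\<lambda>x. g x ^ n)) \<longlonglongrightarrow> integral {a..b} ?l"
  proof (rule dominated_convergence(2))
    show "(\<lambda>x. g x ^ n) integrable_on {a..b}" for n
      using assms(1) by (intro integrable_continuous_interval continuous_intros)
    show "(\<lambda>x. 1::real) integrable_on {a..b}" by auto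
    show "norm (g x ^ n) \<le> 1" if "x \<in> {a..b}" for n x
      using assms(2,3)[OF that] by (simp add: power_le_one)
    show "(\<lambda>n. g x ^ n) \<longlonglongrightarrow> ?l x" if "x \<in> {a..b}" for x
      using assms(2,3)[OF that] by (auto intro: LIMSEQ_realpow_zero)
  qed
  also have "integral {a..b} ?l = integral {a..b} (\<lambda>x. 0)"
    using assms(4) by (intro integral_spike[where S = "{x. g x = 1}"])
      (auto intro: null_sets_completionI countable_imp_null_set_lborel
        simp: negligible_iff_null_sets)
  finally show ?thesis by simp
qed

text \<open>The bound does not depend on \<open>r\<close>, so it controls the supremum over all
  radii at once. The absolute value is there because \<open>r * Re u\<close> exceeds
  \<open>Re u\<close> when \<open>Re u\<close> is negative and \<open>r < 1\<close>. The price is a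
  second point, \<open>u = -1\<close>, where the bound equals 1; this is harmless for a null-set
  argument.\<close>

lemma peak_modulus_bound:
  assumes "cmod u = 1" "0 \<le> r" "r \<le> 1"
  shows "cmod ((1 + of_real r * u) / 2) \<le> sqrt ((1 + \<bar>Re u\<bar>) / 2)"
proof -
  have "(cmod (1 + of_real r * u))\<^sup>2 = 1 + r\<^sup>2 * ((Re u)\<^sup>2 + (Im u)\<^sup>2) + 2 * (r * Re u)"
    by (simp only: cmod_power2) (simp add: algebra_simps power2_eq_square)
  also have "(Re u)\<^sup>2 + (Im u)\<^sup>2 = 1" using assms(1) by (simp flip: cmod_power2)
  also have "1 + r\<^sup>2 * 1 + 2 * (r * Re u) \<le> 2 + 2 * \<bar>Re u\<bar>"
  proof -
    have "r\<^sup>2 \<le> 1" using assms by (simp add: power_le_one)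
    moreover have "r * Re u \<le> r * \<bar>Re u\<bar>" using assms by (intro mult_left_mono) auto
    moreover have "r * \<bar>Re u\<bar> \<le> \<bar>Re u\<bar>" using assms by (simp add: mult_left_le_one_le)
    ultimately show ?thesis by linarith
  qed
  finally have "(cmod ((1 + of_real r * u) / 2))\<^sup>2 \<le> (1 + \<bar>Re u\<bar>) / 2"
    by (simp add: norm_divide power_divide)
  then show ?thesis by (rule real_le_rsqrt)
qed

lemma countable_abs_cos_eq_1: "countable {x. \<bar>cos (x - a)\<bar> = (1::real)}"
proof -
  have "{x. \<bar>cos (x - a)\<bar> = 1} \<subseteq> (\<lambda>i::int. of_int i * pi + a) ` UNIV"
  proof
    fix x assume "x \<in> {x. \<bar>cos (x - a)\<bar> = 1}"
    then have "(cos (x - a))\<^sup>2 = 1" by (simp flip: abs_square_eq_1)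
    then have "sin (x - a) = 0" using sin_cos_squared_add[of "x - a"] by simp
    then obtain i :: int where "x - a = of_int i * pi" by (auto simp: sin_zero_iff_int2)
    then have "x = of_int i * pi + a" by simp
    then show "x \<in> (\<lambda>i::int. of_int i * pi + a) ` UNIV" by blast
  qed
  then show ?thesis by (rule countable_subset) simp
qed

lemma hardy_norm_peak_tendsto_0:
  assumes p: "1 \<le> p" and l: "cmod l = 1"
  shows "(\<lambda>n. hardy_norm p (on_disc (\<lambda>z. ((1 + cnj l * z) / 2) ^ n))) \<longlonglongrightarrow> 0"
proof -
  define a where "a = Arg l"
  have "l = cis a" using l by (metis a_def cis_Arg norm_zero sgn_eq one_neq_zero div_by_1 of_real_1)
  \<comment> \<open>The bound of \<open>peak_modulus_bound\<close> at
    \<open>u = cis (x - a)\<close>, which arises because multiplication by \<open>cnj l\<close>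
    rotates the angle by \<open>- a\<close>.\<close>
  define g where "g x = sqrt ((1 + \<bar>cos (x - a)\<bar>) / 2)" for x
  have g1: "0 \<le> g x" "g x \<le> 1" for x by (auto simp: g_def)
  have "{x. g x = 1} = {x. \<bar>cos (x - a)\<bar> = 1}" by (auto simp: g_def)
  then have cnt: "countable {x. g x = 1}" using countable_abs_cos_eq_1 by simp
  have cont: "continuous_on A g" for A unfolding g_def by (intro continuous_intros) auto
  let ?f = "\<lambda>n. on_disc (\<lambda>z. ((1 + cnj l * z) / 2) ^ n)"
  let ?b = "\<lambda>n. (1 / (2 * pi) * integral {0..2 * pi} (\<lambda>x. g x ^ n)) powr (1 / p)"
  have le: "integral_mean p (?f n) r \<le> ?b n" if r: "r \<in> {0..<1}" for n r
    unfolding integral_mean_def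
  proof (intro powr_mono2 mult_left_mono integral_le)
    have fa: "?f n \<in> disc_analytic" by (intro on_disc_analytic holomorphic_intros) auto
    show int: "(\<lambda>\<theta>. cmod (?f n (of_real r * cis \<theta>)) powr p) integrable_on {0..2 * pi}"
      using p by (intro disc_analytic_powr_integrable[OF fa r]) auto
    show "(\<lambda>x. g x ^ n) integrable_on {0..2 * pi}"
      using cont by (intro integrable_continuous_interval continuous_intros)
    show "0 \<le> 1 / (2 * pi) * integral {0..2 * pi} (\<lambda>\<theta>. cmod (?f n (of_real r * cis \<theta>)) powr p)"
      using int by (intro mult_nonneg_nonneg integral_nonneg) auto
    fix x :: real
    have "cnj l * (of_real r * cis x) = of_real r * cis (x - a)"
      by (simp add: \<open>l = cis a\<close> cis_cnj cis_mult)
    then have "?f n (of_real r * cis x) = ((1 + of_real r * cis (x - a)) / 2) ^ n"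
      using circle_in_unit_disc[OF r, of x] by (simp only: on_disc_simps)
    then have "cmod (?f n (of_real r * cis x)) = cmod ((1 + of_real r * cis (x - a)) / 2) ^ n"
      by (simp only: norm_power)
    also have "\<dots> \<le> g x ^ n"
      using peak_modulus_bound[of "cis (x - a)" r] r by (intro power_mono) (auto simp: g_def)
    finally have "cmod (?f n (of_real r * cis x)) \<le> g x ^ n" .
    then have "cmod (?f n (of_real r * cis x)) powr p \<le> (g x ^ n) powr p"
      using p by (intro powr_mono2) auto
    \<comment> \<open>The base lies in [0, 1], so lowering the exponent from \<open>p\<close> to 1
      can only increase the power.\<close>
    also have "\<dots> \<le> (g x ^ n) powr 1"
      using g1 p by (intro powr_mono') (auto intro: power_le_one)
    finally show "cmod (?f n (of_real r * cis x)) powr p \<le> g x ^ n"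
      using g1 by simp
  qed (use p in auto)
  have up: "hardy_norm p (?f n) \<le> ?b n" for n
    unfolding hardy_norm_def using le by (intro cSUP_least) auto
  have low: "0 \<le> hardy_norm p (?f n)" for n
  proof -
    have "0 \<le> integral_mean p (?f n) 0" by (simp add: integral_mean_def)
    also have "\<dots> \<le> hardy_norm p (?f n)"
      unfolding hardy_norm_def using le by (intro cSUP_upper bdd_aboveI2) auto
    finally show ?thesis .
  qed
  have "(\<lambda>n. 1 / (2 * pi) * integral {0..2 * pi} (\<lambda>x. g x ^ n)) \<longlonglongrightarrow> 1 / (2 * pi) * 0"
    using cont cnt g1 by (intro tendsto_intros integral_power_tendsto_0) auto
  moreover have "0 \<le> 1 / (2 * pi) * integral {0..2 * pi} (\<lambda>x. g x ^ n)" for n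
    using cont g1 by (intro mult_nonneg_nonneg integral_nonneg integrable_continuous_interval
        continuous_intros) auto
  \<comment> \<open>Passing to the limit under the root at base 0 requires nonnegative terms and a
    positive exponent.\<close>
  ultimately have "?b \<longlonglongrightarrow> 0 powr (1 / p)"
    using p by (intro tendsto_powr2) auto
  then have b: "?b \<longlonglongrightarrow> 0" by simp
  show ?thesis
    by (rule tendsto_sandwich[OF _ _ tendsto_const b]) (use up low in auto)
qed

section \<open>Almost multiplicative operators are composition operators\<close>

lemma idempotent_holomorphic_constant:
  assumes "f holomorphic_on S" "connected S" "\<And>z. z \<in> S \<Longrightarrow> f z * f z = f z"
  shows "(\<forall>z\<in>S. f z = 0) \<or> (\<forall>z\<in>S. f z = 1)"
proof -
  have vals: "f z = 0 \<or> f z = 1" if "z \<in> S" for z using assms(3)[OF that] by simp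
  then have "f ` S \<subseteq> {0, 1}" by auto
  then have "finite (f ` S)" by (rule finite_subset) simp
  then have "f constant_on S"
    using assms(1,2) by (meson continuous_finite_range_constant holomorphic_on_imp_continuous_on)
  then show ?thesis using vals unfolding constant_on_def by metis
qed

locale multiplicative_operator =
  fixes p :: real and T :: "(complex \<Rightarrow> complex) \<Rightarrow> (complex \<Rightarrow> complex)"
  assumes p: "1 \<le> p"
    and blo: "bounded_linear_operator_on (hardy_space p) (hardy_norm p) T"
    and nonzero: "\<exists>f\<in>hardy_space p. T f \<noteq> (\<lambda>z. 0)"
    and am: "almost_multiplicative (hardy_space p) T"
begin

abbreviation (input) H where "H \<equiv> hardy_space p"

abbreviation (input) id_disc where "id_disc \<equiv> on_disc (\<lambda>z. z)"

lemma p0: "0 < p" using p by simp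

lemma T_in: "f \<in> H \<Longrightarrow> T f \<in> H"
  and T_add: "f \<in> H \<Longrightarrow> g \<in> H \<Longrightarrow> T (\<lambda>z. f z + g z) = (\<lambda>z. T f z + T g z)"
  and T_scale: "f \<in> H \<Longrightarrow> T (\<lambda>z. c * f z) = (\<lambda>z. c * T f z)"
  using blo unfolding bounded_linear_operator_on_def by blast+

lemma T_holomorphic: "f \<in> H \<Longrightarrow> T f holomorphic_on unit_disc"
  and T_outside: "f \<in> H \<Longrightarrow> z \<notin> unit_disc \<Longrightarrow> T f z = 0"
  using T_in by (auto simp: hardy_space_def disc_analytic_def)

lemma T_mult:
  "f \<in> H \<Longrightarrow> g \<in> H \<Longrightarrow> (\<lambda>z. f z * g z) \<in> H \<Longrightarrow> T (\<lambda>z. f z * g z) = (\<lambda>z. T f z * T g z)"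
  using am unfolding almost_multiplicative_def by blast

lemma one_in: "on_disc (\<lambda>z. 1) \<in> H"
  by (rule hardy_space_bounded[OF p0, where M = 1]) auto

lemma id_in: "id_disc \<in> H"
  by (rule hardy_space_bounded[OF p0, where M = 1]) auto

lemma T_one: "T (on_disc (\<lambda>z. 1)) = on_disc (\<lambda>z. 1)"
proof -
  let ?e = "on_disc (\<lambda>z. 1)"
  have mult: "T f = (\<lambda>z. T ?e z * T f z)" if "f \<in> H" for f
  proof -
    have eq: "(\<lambda>z. ?e z * f z) = f"
      using that by (auto simp: hardy_space_def disc_analytic_def on_disc_def fun_eq_iff)
    show ?thesis by (rule T_mult[OF one_in that, unfolded eq, OF that])
  qed
  have "T ?e z * T ?e z = T ?e z" for z
    by (rule fun_cong[OF mult[OF one_in], symmetric])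
  then have "(\<forall>z\<in>unit_disc. T ?e z = 0) \<or> (\<forall>z\<in>unit_disc. T ?e z = 1)"
    by (intro idempotent_holomorphic_constant T_holomorphic one_in) auto
  \<comment> \<open>If \<open>T\<close> killed the unit, then \<open>T f = T 1 * T f\<close> would
    make \<open>T\<close> zero on the whole space.\<close>
  moreover have "\<not> (\<forall>z\<in>unit_disc. T ?e z = 0)"
  proof
    assume "\<forall>z\<in>unit_disc. T ?e z = 0"
    then have T0: "T ?e = (\<lambda>z. 0)" using T_outside[OF one_in] by blast
    have "T f = (\<lambda>z. 0)" if "f \<in> H" for f
      by (subst mult[OF that]) (simp add: T0)
    then show False using nonzero by blast
  qed
  ultimately show ?thesis using T_outside[OF one_in] by (auto simp: on_disc_def fun_eq_iff)
qed

lemma T_affine: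
  assumes "f \<in> H" "w \<in> unit_disc"
  shows "T (on_disc (\<lambda>z. c * f z + d)) w = c * T f w + d"
proof -
  have cf: "(\<lambda>z. c * f z) \<in> H" if "f \<in> H" for c f
    by (rule hardy_space_dominated[OF p0 _ that, where M = 0 and K = "cmod c"])
      (use that in \<open>auto simp: hardy_space_def disc_analytic_def norm_mult intro: holomorphic_intros\<close>)
  have "on_disc (\<lambda>z. c * f z + d) = (\<lambda>z. c * f z + d * on_disc (\<lambda>z. 1) z)"
    using assms(1) by (auto simp: hardy_space_def disc_analytic_def on_disc_def fun_eq_iff)
  then show ?thesis
    using T_add[OF cf[OF assms(1)] cf[OF one_in]] T_scale[OF assms(1)] T_scale[OF one_in]
      assms(2) by (simp add: T_one)
qed

text \<open>Almost multiplicativity speaks only of products that lie in the space; here the product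
  of \<open>z - a\<close> and \<open>g\<close> does, being \<open>f - c\<close>. Choosing
  \<open>a = T id_disc w\<close> makes the right-hand side vanish, and both applications below do
  so.\<close>

lemma T_factor:
  assumes f: "f \<in> H" and g: "g \<in> H" and w: "w \<in> unit_disc"
    and eq: "\<And>z. z \<in> unit_disc \<Longrightarrow> f z - c = (z - a) * g z"
  shows "T f w - c = (T id_disc w - a) * T g w"
proof -
  have aff: "on_disc (\<lambda>z. f z - c) = on_disc (\<lambda>z. 1 * f z + (- c))"
    "on_disc (\<lambda>z. id_disc z - a) = on_disc (\<lambda>z. 1 * id_disc z + (- a))" by simp_all
  have prod: "on_disc (\<lambda>z. f z - c) = (\<lambda>z. on_disc (\<lambda>z. id_disc z - a) z * g z)"
    using eq g by (auto simp: hardy_space_def disc_analytic_def on_disc_def fun_eq_iff)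
  have "T (on_disc (\<lambda>z. f z - c)) w = T (on_disc (\<lambda>z. id_disc z - a)) w * T g w"
    using T_mult[OF hardy_space_diff_const[OF p0 id_in, of a] g]
      hardy_space_diff_const[OF p0 f, of c] by (simp add: prod)
  then show ?thesis using T_affine[OF f w, of 1 "- c"] T_affine[OF id_in w, of 1 "- a"]
    unfolding aff by simp
qed

lemma T_id_le_1:
  assumes "w \<in> unit_disc"
  shows "cmod (T id_disc w) \<le> 1"
proof (rule ccontr)
  define l where "l = T id_disc w"
  assume "\<not> cmod (T id_disc w) \<le> 1"
  then have l: "1 < cmod l" by (simp add: l_def)
  have far: "cmod l - 1 \<le> cmod (z - l)" if "z \<in> unit_disc" for z
    using that norm_triangle_ineq2[of l z] by (simp add: norm_minus_commute)
  then have ne: "z \<noteq> l" if "z \<in> unit_disc" for z using l that by force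
  have "on_disc (\<lambda>z. 1 / (z - l)) \<in> H"
  proof (rule hardy_space_bounded[OF p0])
    show "(\<lambda>z. 1 / (z - l)) holomorphic_on unit_disc"
      using ne by (intro holomorphic_intros) auto
    show "cmod (1 / (z - l)) \<le> 1 / (cmod l - 1)" if "z \<in> unit_disc" for z
      using far[OF that] l by (auto simp: norm_divide intro: frac_le)
  qed
  \<comment> \<open>The factorization \<open>1 = (z - l) * (1 / (z - l))\<close> with
    \<open>l = T id_disc w\<close>: the left side is 1 and the first factor on the right is
    0.\<close>
  then have "T (on_disc (\<lambda>z. 1)) w - 0 = (T id_disc w - l) * T (on_disc (\<lambda>z. 1 / (z - l))) w"
    by (rule T_factor[OF one_in _ assms]) (use ne in auto)
  then show False using assms by (simp add: T_one l_def)
qed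

lemma T_id_not_unimodular_constant:
  assumes "cmod l = 1"
  shows "\<not> (\<forall>w\<in>unit_disc. T id_disc w = l)"
proof
  assume const: "\<forall>w\<in>unit_disc. T id_disc w = l"
  let ?q = "\<lambda>n. on_disc (\<lambda>z. ((1 + cnj l * z) / 2) ^ n)"
  have q_in: "?q n \<in> H" for n
  proof (rule hardy_space_bounded[OF p0])
    show "cmod (((1 + cnj l * z) / 2) ^ n) \<le> 1" if "z \<in> unit_disc" for z
    proof -
      have "cmod (1 + cnj l * z) \<le> 2"
        using that assms norm_triangle_ineq[of 1 "cnj l * z"] by (simp add: norm_mult)
      then have "cmod ((1 + cnj l * z) / 2) \<le> 1" by (simp add: norm_divide)
      then show ?thesis by (simp only: norm_power) (simp add: power_le_one)
    qed
  qed (auto intro!: holomorphic_intros)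
  \<comment> \<open>\<open>?q 1\<close> is affine in \<open>id_disc\<close>, so its image on the
    disc is \<open>(1 + cnj l * l) / 2 = 1\<close>.\<close>
  have q1: "T (?q 1) = on_disc (\<lambda>z. 1)"
  proof
    fix w
    have "cnj l * l = 1" using complex_norm_square[of l] assms by (simp add: mult.commute)
    moreover have "?q 1 = on_disc (\<lambda>z. (cnj l / 2) * id_disc z + 1 / 2)"
      by (auto simp: on_disc_def fun_eq_iff field_simps)
    ultimately show "T (?q 1) w = on_disc (\<lambda>z. 1) w"
      using T_affine[OF id_in, of w "cnj l / 2" "1 / 2"] const T_outside[OF q_in, of w 1]
      by (cases "w \<in> unit_disc") auto
  qed
  have qn: "T (?q n) = on_disc (\<lambda>z. 1)" for n
  proof (induction n)
    case 0
    show ?case by (simp add: T_one)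
  next
    case (Suc n)
    have "?q (Suc n) = (\<lambda>z. ?q 1 z * ?q n z)" by (auto simp: on_disc_def fun_eq_iff)
    then have "T (?q (Suc n)) = (\<lambda>z. T (?q 1) z * T (?q n) z)"
      using T_mult[OF q_in[of 1] q_in[of n]] q_in[of "Suc n"] by simp
    then show ?case by (simp only: Suc q1) (auto simp: on_disc_def)
  qed
  obtain C where C: "\<And>f. f \<in> H \<Longrightarrow> hardy_norm p (T f) \<le> C * hardy_norm p f"
    using blo unfolding bounded_linear_operator_on_def by blast
  \<comment> \<open>All \<open>?q n\<close> have the same image 1, of norm at least 1, while their
    own norms tend to 0; this contradicts boundedness of \<open>T\<close>.\<close>
  have "1 \<le> C * hardy_norm p (?q n)" for n
    using C[OF q_in[of n]] hardy_norm_one[OF p0] unfolding qn by linarith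
  moreover have "(\<lambda>n. C * hardy_norm p (?q n)) \<longlonglongrightarrow> C * 0"
    by (intro tendsto_intros hardy_norm_peak_tendsto_0 p assms)
  ultimately have "1 \<le> C * 0" by (intro LIMSEQ_le_const) auto
  then show False by simp
qed

lemma T_id_less_1:
  assumes "w \<in> unit_disc"
  shows "T id_disc w \<in> unit_disc"
proof (rule ccontr)
  assume "T id_disc w \<notin> unit_disc"
  then have w1: "cmod (T id_disc w) = 1" using T_id_le_1[OF assms] by simp
  \<comment> \<open>The modulus attains its maximum 1 at the interior point
    \<open>w\<close>.\<close>
  have "T id_disc constant_on unit_disc"
    by (rule maximum_modulus_principle[OF T_holomorphic[OF id_in], of unit_disc w])
      (use assms T_id_le_1 w1 in auto)
  then show False
    using T_id_not_unimodular_constant[OF w1] assms unfolding constant_on_def by metis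
qed

lemma composition: "composition_operator H T"
  unfolding composition_operator_def
proof (intro exI conjI ballI)
  show "T id_disc holomorphic_on unit_disc" by (rule T_holomorphic[OF id_in])
  show "T id_disc ` unit_disc \<subseteq> unit_disc" using T_id_less_1 by blast
  fix f w assume f: "f \<in> H" and w: "w \<in> unit_disc"
  obtain g where "g \<in> H"
    "\<And>z. z \<in> unit_disc \<Longrightarrow> f z - f (T id_disc w) = (z - T id_disc w) * g z"
    by (rule hardy_space_divide_root[OF p0 f T_id_less_1[OF w]]) blast
  then show "T f w = f (T id_disc w)" using T_factor[OF f _ w] by fastforce
qed

end

section \<open>The equivalence\<close>

theorem theorem2p5:
  fixes p :: real and T :: "(complex \<Rightarrow> complex) \<Rightarrow> (complex \<Rightarrow> complex)"
  assumes "1 \<le> p"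
    and "bounded_linear_operator_on (hardy_space p) (hardy_norm p) T"
    and "\<exists>f\<in>hardy_space p. T f \<noteq> (\<lambda>z. 0)"
  shows "almost_multiplicative (hardy_space p) T \<longleftrightarrow> composition_operator (hardy_space p) T"
proof
  assume "almost_multiplicative (hardy_space p) T"
  then interpret multiplicative_operator p T
    using assms by unfold_locales
  show "composition_operator (hardy_space p) T" by (rule composition)
next
  assume "composition_operator (hardy_space p) T"
  then obtain \<phi> where \<phi>: "\<And>f z. f \<in> hardy_space p \<Longrightarrow> z \<in> unit_disc \<Longrightarrow> T f z = f (\<phi> z)"
    unfolding composition_operator_def by blast
  \<comment> \<open>The composition formula covers only points of the disc; elsewhere both sides of
    the product rule vanish because \<open>T\<close> maps into the space.\<close>
  have out: "T f z = 0" if "f \<in> hardy_space p" "z \<notin> unit_disc" for f z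
    using assms(2) that
    by (auto simp: bounded_linear_operator_on_def hardy_space_def disc_analytic_def)
  show "almost_multiplicative (hardy_space p) T"
    unfolding almost_multiplicative_def
  proof (intro ballI impI ext)
    fix f g z
    assume "f \<in> hardy_space p" "g \<in> hardy_space p" "(\<lambda>z. f z * g z) \<in> hardy_space p"
    then show "T (\<lambda>z. f z * g z) z = T f z * T g z"
      using \<phi> out by (cases "z \<in> unit_disc") auto
  qed
qed

end
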